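(* Let $X=\{-1,1\}^{\mathbb N}$, $h\in\mathbb R$, and let $(a_k)_{k\ge1}$ satisfy $a_k\ge0$ and $\sum_{k\ge1}a_k<\infty$. Let $A(x)=hx_0+x_0\sum_{k\ge1}a_kx_k$, and let $\mu^{+},\mu^{-}$ be the Borel probability measures on $X$ determined by $$\int_X\varphi\,d\mu^{\pm}=\lim_{n\to\infty}\frac{\mathscr L_A^n(\varphi)(\pm1^\infty)}{\mathscr L_A^n(1)(\pm1^\infty)}\qquad\text{for all }\varphi\in\mathscr A .$$ If $\mu^{+}=\mu^{-}$, then $\mathcal G^*(A)$ is a singleton.
   Context: $\mathbb N=\{0,1,2,\dots\}$; $1^\infty=(1,1,\dots)$, $-1^\infty=(-1,-1,\dots)$. The Ruelle operator is $\mathscr L_A(f)(x)=\sum_{i\in\{-1,1\}}e^{A(i,x_0,x_1,\dots)}f(i,x_0,x_1,\dots)$ on $C(X)$ (supremum norm), $\lambda_A$ is its spectral radius, and $\mathcal G^*(A)$ is the set of Borel probability measures $\nu$ on $X$ with $\mathscr L_A^*\nu=\lambda_A\nu$ (eigenprobabilities). For finite $B\subset\mathbb N$, $\varphi_B(x)=\prod_{i\in B}\frac12(1+x_i)$ (with $\varphi_\emptyset\equiv1$), and $\mathscr A$ is the algebra of all finite real linear combinations of the $\varphi_B$; it is dense in $C(X)$. For the potentials considered the displayed limits exist for all $\varphi\in\mathscr A$ and define unique Borel probability measures $\mu^\pm$. *)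

theory Defs
  imports "HOL-Probability.Probability"
begin

typedef spin = "{-1, 1 :: real}"
  morphisms val Spin
  by blast

instance spin :: finite
proof
  have "(UNIV :: spin set) = Spin ` {-1, 1}"
    using type_definition.Abs_image[OF type_definition_spin] by simp
  then show "finite (UNIV :: spin set)"
    by (metis finite.emptyI finite.insertI finite_imageI)
qed

instantiation spin :: discrete_topology
begin

definition open_spin :: "spin set \<Rightarrow> bool"
  where "open_spin S \<longleftrightarrow> True"

instance
  by standard (simp_all add: open_spin_def)

end

instance spin :: second_countable_topology
proof
  have "generate_topology (UNIV :: spin set set) S" for S
    by (rule generate_topology.Basis) simp
  then show "\<exists>B :: spin set set. countable B \<and> open = generate_topology B"
    by (intro exI[of _ UNIV]) (auto simp: open_spin_def fun_eq_iff intro: countable_finite)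
qed

text \<open>
  The space \<open>X = {-1,1}\<^sup>\<nat>\<close> is the type of configurations below; its topology is the library's
  product topology on function types, and its Borel sets are those of \<^const>\<open>borel\<close>.
\<close>

type_synonym config = "nat \<Rightarrow> spin"

definition all_plus :: config
  where "all_plus = (\<lambda>_. Spin 1)"

definition all_minus :: config
  where "all_minus = (\<lambda>_. Spin (-1))"

text \<open>
  \<^term>\<open>case_nat i x\<close> is the sequence \<open>(i, x 0, x 1, \<dots>)\<close>. The value type is kept general so that
  the same operator acts on real and on complex functions.
\<close>

definition ruelle :: "(config \<Rightarrow> real) \<Rightarrow> (config \<Rightarrow> 'b::real_vector) \<Rightarrow> config \<Rightarrow> 'b"
  where "ruelle A f x = (\<Sum>i\<in>UNIV. exp (A (case_nat i x)) *\<^sub>R f (case_nat i x))"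

text \<open>
  The spectrum of an operator on \<open>C(X)\<close> is, as usual, that of its complexification, so it is taken on
  the complex-valued continuous functions with the supremum norm: \<open>z\<close> is outside the spectrum iff
  \<open>z - T\<close> is a bijection of that space whose inverse is bounded.
\<close>

definition cont_complex :: "(config \<Rightarrow> complex) set"
  where "cont_complex = {f. continuous_on UNIV f}"

definition sup_norm :: "(config \<Rightarrow> complex) \<Rightarrow> real"
  where "sup_norm f = (SUP x. norm (f x))"

definition op_spectrum :: "((config \<Rightarrow> complex) \<Rightarrow> config \<Rightarrow> complex) \<Rightarrow> complex set"
  where "op_spectrum T = {z. \<not> (bij_betw (\<lambda>f x. z * f x - T f x) cont_complex cont_complex \<and>
    (\<exists>K. \<forall>f\<in>cont_complex. sup_norm f \<le> K * sup_norm (\<lambda>x. z * f x - T f x)))}"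

definition op_spectral_radius :: "((config \<Rightarrow> complex) \<Rightarrow> config \<Rightarrow> complex) \<Rightarrow> real"
  where "op_spectral_radius T = (SUP z\<in>op_spectrum T. norm z)"

definition ruelle_radius :: "(config \<Rightarrow> real) \<Rightarrow> real"
  where "ruelle_radius A = op_spectral_radius (ruelle A)"

definition borel_probability :: "config measure \<Rightarrow> bool"
  where "borel_probability \<nu> \<longleftrightarrow> prob_space \<nu> \<and> sets \<nu> = sets borel"

text \<open>
  The dual operator is determined by \<open>\<integral>f d(L\<^sup>*\<nu>) = \<integral>(L f) d\<nu>\<close> for real continuous \<open>f\<close>, so the
  eigenvalue equation for \<open>\<nu>\<close> is tested against all such functions.
\<close>

definition eigenprobabilities :: "(config \<Rightarrow> real) \<Rightarrow> config measure set"
  where "eigenprobabilities A = {\<nu>. borel_probability \<nu> \<and>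
    (\<forall>f :: config \<Rightarrow> real. continuous_on UNIV f \<longrightarrow>
      (\<integral>x. ruelle A f x \<partial>\<nu>) = ruelle_radius A * (\<integral>x. f x \<partial>\<nu>))}"

definition phi :: "nat set \<Rightarrow> config \<Rightarrow> real"
  where "phi B x = (\<Prod>i\<in>B. (1 / 2) * (1 + val (x i)))"

definition phi_algebra :: "(config \<Rightarrow> real) set"
  where "phi_algebra = {\<lambda>x. \<Sum>B\<in>F. c B * phi B x | F c. finite F \<and> (\<forall>B\<in>F. finite B)}"

definition boundary_limit :: "(config \<Rightarrow> real) \<Rightarrow> config \<Rightarrow> config measure \<Rightarrow> bool"
  where "boundary_limit A y \<mu> \<longleftrightarrow> borel_probability \<mu> \<and>
    (\<forall>\<phi>\<in>phi_algebra.
      (\<lambda>n. (ruelle A ^^ n) \<phi> y / (ruelle A ^^ n) (\<lambda>_. 1) y) \<longlonglongrightarrow> (\<integral>x. \<phi> x \<partial>\<mu>))"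

text \<open>
  The coefficients are indexed from 1, hence the shift; \<^term>\<open>a 0\<close> plays no role.
\<close>

definition ising_potential :: "real \<Rightarrow> (nat \<Rightarrow> real) \<Rightarrow> config \<Rightarrow> real"
  where "ising_potential h a x =
    h * val (x 0) + val (x 0) * (\<Sum>k. a (Suc k) * val (x (Suc k)))"

end

theory Submission
  imports Defs
begin

text \<open>
  For a ferromagnetic potential the functions \<open>L\<^sup>n 1\<close> are log-supermodular, which makes
  \<open>x \<mapsto> L\<^sup>n \<phi> x / L\<^sup>n 1 x\<close> increasing for every increasing \<open>\<phi>\<close>. The ratios are therefore squeezed
  between those at the two extremal boundary conditions, and if these have the same limit \<open>\<mu>\<close>, then
  \<open>L\<^sup>n f / L\<^sup>n 1\<close> converges uniformly to \<open>\<integral> f d\<mu>\<close>, first for \<open>f = \<phi>\<^sub>B\<close> and by density for all continuous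
  \<open>f\<close>. Replacing \<open>f\<close> by \<open>L f\<close> shows that \<open>\<mu>\<close> is an eigenmeasure for \<open>\<lambda> = \<integral> L 1 d\<mu>\<close>, without a fixed point
  theorem. Uniformity also bounds \<open>L\<^sup>n 1\<close> by \<open>C r\<^sup>n\<close> for every \<open>r > \<lambda>\<close>, so \<open>\<lambda>\<close> is the spectral radius, and
  integrating \<open>L\<^sup>n f \<approx> (\<integral> f d\<mu>) L\<^sup>n 1\<close> against an eigenprobability \<open>\<nu>\<close> gives \<open>\<nu> = \<mu>\<close>.
\<close>

section \<open>The configuration space\<close>

lemma val_cases: "val s = 1 \<or> val s = -1"
  using val[of s] by auto

lemma val_Spin [simp]: "val (Spin 1) = 1" "val (Spin (-1)) = -1"
  by (simp_all add: Spin_inverse)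

lemma Spin_neq [simp]: "Spin 1 \<noteq> Spin (-1)" "Spin (-1) \<noteq> Spin 1"
  by (metis val_Spin one_neq_neg_one)+

lemma val_eq_iff [simp]: "val s = 1 \<longleftrightarrow> s = Spin 1" "val s = -1 \<longleftrightarrow> s = Spin (-1)"
  by (metis val_inverse val_Spin)+

lemma spin_cases: "s = Spin 1 \<or> s = Spin (-1)"
  using val_cases[of s] by simp

lemma abs_val [simp]: "\<bar>val s\<bar> = 1"
  using spin_cases[of s] by auto

lemma UNIV_spin: "(UNIV :: spin set) = {Spin 1, Spin (-1)}"
  using spin_cases by auto

section \<open>The pointwise order and lattice structure of configurations\<close>

instantiation spin :: linorder
begin

definition less_eq_spin :: "spin \<Rightarrow> spin \<Rightarrow> bool"
  where "s \<le> t \<longleftrightarrow> val s \<le> val t"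

definition less_spin :: "spin \<Rightarrow> spin \<Rightarrow> bool"
  where "s < t \<longleftrightarrow> val s < val t"

instance
  by standard (auto simp: less_eq_spin_def less_spin_def val_inject)

end

instantiation spin :: lattice
begin

definition inf_spin :: "spin \<Rightarrow> spin \<Rightarrow> spin"
  where "inf_spin = min"

definition sup_spin :: "spin \<Rightarrow> spin \<Rightarrow> spin"
  where "sup_spin = max"

instance
  by standard (auto simp: inf_spin_def sup_spin_def)

end

lemma Spin_le [simp]: "Spin (-1) \<le> s" "s \<le> Spin 1"
  using spin_cases[of s] by (auto simp: less_eq_spin_def)

lemma all_minus_le: "all_minus \<le> x" and le_all_plus: "x \<le> all_plus"
  by (simp_all add: le_fun_def all_minus_def all_plus_def)

lemma case_nat_mono: "i \<le> j \<Longrightarrow> x \<le> y \<Longrightarrow> case_nat i x \<le> (case_nat j y :: config)"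
  by (auto simp: le_fun_def split: nat.split)

lemma sup_case_nat: "sup (case_nat i x) (case_nat j y) = (case_nat (sup i j) (sup x y) :: config)"
  and inf_case_nat: "inf (case_nat i x) (case_nat j y) = (case_nat (inf i j) (inf x y) :: config)"
  by (auto simp: fun_eq_iff split: nat.split)

text \<open>If the pairs (s, t) and (s', t') are comparable, both sides agree. Otherwise the pairs
  are (1, -1) and (-1, 1), and -2 stands against 2. This is the ferromagnetic attraction between two
  sites.\<close>

lemma val_supermodular:
  "val s * val t + val s' * val t' \<le>
    val (sup s s') * val (sup t t') + val (inf s s') * val (inf t t')"
  using spin_cases[of s] spin_cases[of t] spin_cases[of s'] spin_cases[of t']
  by (elim disjE) (simp_all add: sup_spin_def inf_spin_def max_def min_def less_eq_spin_def)

text \<open>\<open>sup\<close> and \<open>inf\<close> only permute \<open>s\<close> and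
  \<open>t\<close>. Since equality holds, the field term will be admissible for either sign of
  \<open>h\<close>.\<close>

lemma val_modular: "val (sup s t) + val (inf s t) = val s + val t"
  by (auto simp add: sup_spin_def inf_spin_def max_def min_def)

text \<open>With this metric \<open>config\<close> becomes a metric space under the product metric
  over a countable index set, hence Hausdorff, as the Stone-Weierstrass theorem requires.\<close>

instantiation spin :: metric_space
begin

definition dist_spin :: "spin \<Rightarrow> spin \<Rightarrow> real"
  where "dist_spin s t = \<bar>val s - val t\<bar>"

definition uniformity_spin :: "(spin \<times> spin) filter"
  where "uniformity_spin = (INF e\<in>{0<..}. principal {(s, t). dist s t < e})"

instance
proof
  fix U :: "spin set"
  have "\<forall>\<^sub>F (s', t) in uniformity. s' = s \<longrightarrow> t \<in> U" if "s \<in> U" for s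
    unfolding uniformity_spin_def
  \<comment> \<open>Distinct spins are at distance 2, so radius 1 isolates every point.\<close>
  proof (rule eventually_INF1[of 1])
    show "\<forall>\<^sub>F (s', t) in principal {(s, t). dist s t < 1}. s' = s \<longrightarrow> t \<in> U"
      unfolding eventually_principal
    proof clarify
      fix s' t
      assume "dist s t < 1"
      then have "s = t"
        using spin_cases[of s] spin_cases[of t] by (auto simp: dist_spin_def)
      then show "t \<in> U" using \<open>s \<in> U\<close> by simp
    qed
  qed simp
  then show "open U \<longleftrightarrow> (\<forall>s\<in>U. \<forall>\<^sub>F (s', t) in uniformity. s' = s \<longrightarrow> t \<in> U)"
    by (auto simp: open_spin_def)
qed (auto simp: dist_spin_def uniformity_spin_def val_inject)

end

lemma compact_UNIV_config: "compact (UNIV :: config set)"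
proof -
  have "compact_space (euclidean :: spin topology)"
    by (simp add: compact_space_def finite_imp_compact)
  then have "compact_space (product_topology (\<lambda>_ :: nat. euclidean :: spin topology) UNIV)"
    by (simp add: compact_space_product_topology)
  then show ?thesis
    by (simp add: euclidean_product_topology compact_space_def)
qed

lemma continuous_bounded:
  fixes f :: "config \<Rightarrow> 'b::real_normed_vector"
  assumes "continuous_on UNIV f"
  obtains K where "0 < K" "\<And>x. norm (f x) \<le> K"
proof -
  have "bounded (range f)"
    using compact_continuous_image[OF assms compact_UNIV_config] compact_imp_bounded by auto
  then show thesis
    using that by (auto simp: bounded_pos)
qed

lemma continuous_val: "continuous_on UNIV (\<lambda>x :: config. val (x i))"
proof -
  have "continuous_on UNIV val"
    by (simp add: continuous_on_open_vimage open_discrete)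
  from continuous_on_compose2[OF this continuous_on_product_coordinates[of i]]
  show ?thesis by simp
qed

lemma continuous_case_nat: "continuous_on UNIV (\<lambda>x. case_nat i x :: config)"
proof (rule continuous_on_coordinatewise_then_product)
  show "continuous_on UNIV (\<lambda>x. case k of 0 \<Rightarrow> i | Suc j \<Rightarrow> x j)" for k
    by (cases k) auto
qed

lemma continuous_on_case_nat:
  fixes f :: "config \<Rightarrow> 'b::topological_space"
  assumes "continuous_on UNIV f"
  shows "continuous_on UNIV (\<lambda>x. f (case_nat i x))"
  using continuous_on_compose2[OF assms continuous_case_nat] by simp

section \<open>The cylinder indicators \<open>phi B\<close> and the density of their span\<close>

lemma phi_eq: "finite B \<Longrightarrow> phi B x = of_bool (\<forall>i\<in>B. x i = Spin 1)"
proof (induction B rule: finite_induct)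
  case (insert i B)
  then show ?case
    using spin_cases[of "x i"] by (auto simp: phi_def)
qed (simp add: phi_def)

lemma phi_mult: "finite B \<Longrightarrow> finite C \<Longrightarrow> phi B x * phi C x = phi (B \<union> C) x"
  by (auto simp: phi_eq)

lemma phi_mono: "finite B \<Longrightarrow> mono (phi B)"
proof (rule monoI)
  fix x y :: config
  assume "finite B" "x \<le> y"
  moreover have "y i = Spin 1" if "x i = Spin 1" for i
    using that le_funD[OF \<open>x \<le> y\<close>, of i] Spin_le(2)[of "y i"] by (simp add: order.eq_iff)
  ultimately show "phi B x \<le> phi B y"
    by (auto simp: phi_eq)
qed

lemma continuous_phi: "continuous_on UNIV (phi B)"
  unfolding phi_def[abs_def] by (intro continuous_intros continuous_val)

lemma phi_in_phi_algebra: "finite B \<Longrightarrow> phi B \<in> phi_algebra"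
  unfolding phi_algebra_def
  by (rule CollectI, rule exI[of _ "{B}"], rule exI[of _ "\<lambda>_. 1"]) simp

text \<open>An inductive description of the span allows linear statements to be proved by induction
  from a single \<open>phi B\<close>. Only those single functions have to be found in
  \<open>phi_algebra\<close>.\<close>

inductive phi_span :: "(config \<Rightarrow> real) \<Rightarrow> bool" where
  base: "finite B \<Longrightarrow> phi_span (\<lambda>x. c * phi B x)"
| add: "phi_span f \<Longrightarrow> phi_span g \<Longrightarrow> phi_span (\<lambda>x. f x + g x)"

lemma continuous_phi_span: "phi_span f \<Longrightarrow> continuous_on UNIV f"
  by (induction rule: phi_span.induct) (auto intro!: continuous_intros continuous_phi)

text \<open>By bilinearity it is enough to multiply two generators, and the product of the
  indicators for \<open>B\<close> and \<open>C\<close> is the one for their union.\<close>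

lemma phi_span_mult:
  assumes "phi_span f" "phi_span g"
  shows "phi_span (\<lambda>x. f x * g x)"
  using assms
proof (induction arbitrary: g rule: phi_span.induct)
  case (base B c)
  from base(2) show ?case
  proof (induction rule: phi_span.induct)
    case (base C d)
    have "phi_span (\<lambda>x. (c * d) * phi (B \<union> C) x)"
      using base \<open>finite B\<close> by (intro phi_span.base) auto
    moreover have "(\<lambda>x. (c * d) * phi (B \<union> C) x) = (\<lambda>x. c * phi B x * (d * phi C x))"
      using base \<open>finite B\<close> by (simp add: phi_mult[symmetric] ac_simps)
    ultimately show ?case by simp
  next
    case (add f g)
    then show ?case
      using phi_span.add by (simp add: distrib_left)
  qed
next
  case (add f1 f2)
  then show ?case
    using phi_span.add by (simp add: distrib_right)
qed

text \<open>Stone-Weierstrass: constants are multiples of \<open>phi {}\<close>, and two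
  configurations that differ at site \<open>i\<close> are separated by
  \<open>phi {i}\<close>.\<close>

lemma phi_span_dense:
  assumes "continuous_on UNIV f" "0 < e"
  obtains g where "phi_span g" "\<And>x. \<bar>f x - g x\<bar> < e"
proof -
  interpret function_ring_on "Collect phi_span" "UNIV :: config set"
  proof
    show "(\<lambda>_. c) \<in> Collect phi_span" for c
      using phi_span.base[of "{}" c] by (simp add: phi_def)
    fix x y :: config
    assume "x \<noteq> y"
    then obtain i where "x i \<noteq> y i" by auto
    then have "phi {i} x \<noteq> phi {i} y"
      using spin_cases[of "x i"] spin_cases[of "y i"] by (auto simp: phi_eq)
    moreover have "phi_span (phi {i})"
      using phi_span.base[of "{i}" 1] by simp
    ultimately show "\<exists>f\<in>Collect phi_span. f x \<noteq> f y" by blast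
  qed (auto simp: compact_UNIV_config continuous_phi_span phi_span_mult phi_span.add)
  show thesis
    using Stone_Weierstrass_basic[OF assms] that by auto
qed

section \<open>Borel probabilities are determined by the integrals of \<open>phi B\<close>\<close>

lemma space_borel_probability: "borel_probability \<mu> \<Longrightarrow> space \<mu> = UNIV"
  by (metis borel_probability_def sets_eq_imp_space_eq space_borel)

lemma integrable_continuous:
  fixes f :: "config \<Rightarrow> real"
  assumes "borel_probability \<mu>" "continuous_on UNIV f"
  shows "integrable \<mu> f"
proof -
  interpret prob_space \<mu> using assms by (simp add: borel_probability_def)
  obtain K where "\<And>x. norm (f x) \<le> K"
    using continuous_bounded[OF assms(2)] by blast
  moreover have "f \<in> borel_measurable \<mu>"
    using assms borel_measurable_continuous_onI measurable_cong_sets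
    by (metis borel_probability_def)
  ultimately show ?thesis
    by (intro integrable_const_bound[where B = K]) auto
qed

text \<open>The Borel sets are generated by single coordinates, and \<open>{Spin 1}\<close> and its
  complement are the only nontrivial subsets of \<open>spin\<close>. Requiring several spins at once
  makes the generator stable under intersection.\<close>

lemma sets_borel_config:
  "sets (borel :: config measure) = sigma_sets UNIV {{x. \<forall>i\<in>B. x i = Spin 1} | B. finite B}"
  (is "_ = sigma_sets UNIV ?E")
proof
  have single: "{x :: config. x i \<in> S} \<in> sigma_sets UNIV ?E" for i S
  proof -
    have E: "{x :: config. x i = Spin 1} \<in> sigma_sets UNIV ?E"
      by (rule sigma_sets.Basic, rule CollectI, rule exI[of _ "{i}"]) simp
    have c: "UNIV - {x :: config. x i = Spin 1} = {x. x i = Spin (-1)}"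
      using spin_cases by force
    have "S = {} \<or> S = {Spin 1} \<or> S = {Spin (-1)} \<or> S = UNIV"
      using PowI[OF subset_UNIV[of S]] unfolding UNIV_spin Pow_insert by auto
    then show ?thesis
      using E sigma_sets.Compl[OF E, unfolded c] sigma_sets.Empty[of UNIV ?E] sigma_sets_top[of UNIV ?E]
      by auto
  qed
  have "sets (borel :: config measure) = sets (Pi\<^sub>M UNIV (\<lambda>_ :: nat. borel :: spin measure))"
    by (simp add: sets_PiM_equal_borel)
  also have "\<dots> \<subseteq> sigma_sets UNIV ?E"
    unfolding sets_PiM_single using single by (auto intro!: sigma_sets_mono)
  finally show "sets borel \<subseteq> sigma_sets UNIV ?E" .
  have "{x :: config. x i = Spin 1} \<in> sets borel" for i
    using measurable_sets[OF measurable_product_coordinates[of i], of "{Spin 1}"]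
    by (simp add: vimage_def)
  then have "{x :: config. \<forall>i\<in>B. x i = Spin 1} \<in> sets borel" if "finite B" for B
    using sets.sets_Collect_finite_All[of B "borel :: config measure"] that by simp
  then show "sigma_sets UNIV ?E \<subseteq> sets borel"
    by (intro sets.sigma_sets_subset') auto
qed

text \<open>The integral of \<open>phi B\<close> is the measure of a generating cylinder, so two
  measures with the same integrals agree on a pi-system. The cylinder for the empty \<open>B\<close>
  is the whole space.\<close>

lemma borel_probability_eqI:
  assumes \<mu>: "borel_probability \<mu>" and \<nu>: "borel_probability \<nu>"
    and eq: "\<And>B. finite B \<Longrightarrow> (\<integral>x. phi B x \<partial>\<mu>) = (\<integral>x. phi B x \<partial>\<nu>)"
  shows "\<mu> = \<nu>"
proof (rule measure_eqI_generator_eq)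
  let ?E = "{{x :: config. \<forall>i\<in>B. x i = Spin 1} | B. finite B}"
  show "sets \<mu> = sigma_sets UNIV ?E" "sets \<nu> = sigma_sets UNIV ?E"
    using \<mu> \<nu> by (simp_all add: borel_probability_def sets_borel_config)
  show "Int_stable ?E"
  proof (clarsimp simp: Int_stable_def)
    fix B C :: "nat set"
    assume "finite B" "finite C"
    then show "\<exists>D. {x :: config. \<forall>i\<in>B. x i = Spin 1} \<inter> {x. \<forall>i\<in>C. x i = Spin 1} =
        {x. \<forall>i\<in>D. x i = Spin 1} \<and> finite D"
      by (intro exI[of _ "B \<union> C"]) auto
  qed
  show "range (\<lambda>_. UNIV) \<subseteq> ?E" by auto
  have m: "emeasure \<rho> {x. \<forall>i\<in>B. x i = Spin 1} = ennreal (\<integral>x. phi B x \<partial>\<rho>)"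
    if "borel_probability \<rho>" "finite B" for \<rho> B
  proof -
    interpret prob_space \<rho> using that by (simp add: borel_probability_def)
    have "phi B = indicator {x. \<forall>i\<in>B. x i = Spin 1}"
      using that by (auto simp: phi_eq indicator_def)
    then show ?thesis
      using that by (simp add: space_borel_probability emeasure_eq_measure)
  qed
  show "emeasure \<mu> S = emeasure \<nu> S" if "S \<in> ?E" for S
    using that eq m \<mu> \<nu> by auto
  interpret prob_space \<mu> using \<mu> by (simp add: borel_probability_def)
  show "emeasure \<mu> UNIV \<noteq> \<infinity>" for i :: nat
    by simp
qed auto


section \<open>The Ruelle operator\<close>

lemma ruelle_eq:
  "ruelle A f x = exp (A (case_nat (Spin 1) x)) *\<^sub>R f (case_nat (Spin 1) x) +
    exp (A (case_nat (Spin (-1)) x)) *\<^sub>R f (case_nat (Spin (-1)) x)"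
  by (simp add: ruelle_def UNIV_spin)

lemma continuous_ruelle:
  fixes f :: "config \<Rightarrow> 'b::real_normed_vector"
  assumes "continuous_on UNIV A" "continuous_on UNIV f"
  shows "continuous_on UNIV (ruelle A f)"
  unfolding ruelle_eq[abs_def]
  using assms by (intro continuous_intros continuous_on_case_nat)

lemma continuous_ruelle_pow:
  fixes f :: "config \<Rightarrow> 'b::real_normed_vector"
  assumes "continuous_on UNIV A" "continuous_on UNIV f"
  shows "continuous_on UNIV ((ruelle A ^^ n) f)"
  by (induction n) (simp_all add: assms continuous_ruelle)

lemma ruelle_pow_add:
  "(ruelle A ^^ n) (\<lambda>x. f x + g x) = (\<lambda>x. (ruelle A ^^ n) f x + (ruelle A ^^ n) g x)"
  by (induction n) (auto simp: ruelle_eq algebra_simps)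

lemma ruelle_pow_cmult:
  fixes f :: "config \<Rightarrow> 'b::real_algebra"
  shows "(ruelle A ^^ n) (\<lambda>x. c * f x) = (\<lambda>x. c * (ruelle A ^^ n) f x)"
  by (induction n) (auto simp: ruelle_eq algebra_simps)

lemma ruelle_pow_mono:
  fixes f g :: "config \<Rightarrow> real"
  assumes "\<And>x. f x \<le> g x"
  shows "(ruelle A ^^ n) f x \<le> (ruelle A ^^ n) g x"
  by (induction n arbitrary: x) (auto simp: ruelle_eq assms intro!: add_mono)

lemma ruelle_pow_one_pos: "0 < (ruelle A ^^ n) (\<lambda>_. 1 :: real) x"
  by (induction n arbitrary: x) (auto simp: ruelle_eq add_pos_pos)

text \<open>The operator has positive weights, so the norm can be moved inside and then replaced by
  its bound. The general value type serves both the real ratios and the complex resolvent.\<close>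

lemma norm_ruelle_pow_le:
  fixes f :: "config \<Rightarrow> 'b::real_normed_vector"
  assumes "\<And>x. norm (f x) \<le> s"
  shows "norm ((ruelle A ^^ n) f x) \<le> s * (ruelle A ^^ n) (\<lambda>_. 1) x"
proof -
  have "norm ((ruelle A ^^ n) f x) \<le> (ruelle A ^^ n) (\<lambda>x. norm (f x)) x"
  proof (induction n arbitrary: x)
    case (Suc n)
    have "norm (ruelle A ((ruelle A ^^ n) f) x) \<le> ruelle A (\<lambda>x. norm ((ruelle A ^^ n) f x)) x"
      unfolding ruelle_eq by (rule norm_triangle_le) simp
    also have "\<dots> \<le> ruelle A ((ruelle A ^^ n) (\<lambda>x. norm (f x))) x"
      by (auto simp: ruelle_eq intro!: add_mono Suc)
    finally show ?case by simp
  qed simp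
  also have "\<dots> \<le> (ruelle A ^^ n) (\<lambda>x. s * 1) x"
    by (rule ruelle_pow_mono) (simp add: assms)
  also have "\<dots> = s * (ruelle A ^^ n) (\<lambda>_. 1) x"
    by (simp only: ruelle_pow_cmult)
  finally show ?thesis .
qed

text \<open>For fixed \<open>n\<close> and \<open>y\<close> this is the expectation of
  \<open>f\<close> under the finite-volume Gibbs measure on the first \<open>n\<close> sites with
  boundary condition \<open>y\<close>.\<close>

definition finite_gibbs :: "(config \<Rightarrow> real) \<Rightarrow> nat \<Rightarrow> (config \<Rightarrow> real) \<Rightarrow> config \<Rightarrow> real"
  where "finite_gibbs A n f y = (ruelle A ^^ n) f y / (ruelle A ^^ n) (\<lambda>_. 1) y"

lemma finite_gibbs_add:
  "finite_gibbs A n (\<lambda>x. f x + g x) y = finite_gibbs A n f y + finite_gibbs A n g y"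
  by (simp add: finite_gibbs_def ruelle_pow_add add_divide_distrib)

lemma finite_gibbs_cmult: "finite_gibbs A n (\<lambda>x. c * f x) y = c * finite_gibbs A n f y"
  by (simp add: finite_gibbs_def ruelle_pow_cmult)

lemma finite_gibbs_diff:
  "finite_gibbs A n (\<lambda>x. f x - g x) y = finite_gibbs A n f y - finite_gibbs A n g y"
  using finite_gibbs_add[of A n f "\<lambda>x. - 1 * g x" y]
  unfolding finite_gibbs_cmult by simp

lemma abs_finite_gibbs_le:
  assumes "\<And>x. \<bar>f x\<bar> \<le> s"
  shows "\<bar>finite_gibbs A n f y\<bar> \<le> s"
  using norm_ruelle_pow_le[of f s n A y] assms ruelle_pow_one_pos[of n A y]
  by (simp add: finite_gibbs_def abs_divide pos_divide_le_eq)


section \<open>Monotonicity in the boundary condition\<close>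

text \<open>This is the FKG lattice condition for a strictly positive weight.\<close>

definition log_supermodular :: "(config \<Rightarrow> real) \<Rightarrow> bool"
  where "log_supermodular g \<longleftrightarrow> (\<forall>x. 0 < g x) \<and> (\<forall>x y. g x * g y \<le> g (sup x y) * g (inf x y))"

text \<open>The Ahlswede-Daykin inequality on a two-point lattice. The mixed products
  \<open>u\<close> and \<open>v\<close> are at most \<open>p\<close>, and their product is at most
  \<open>p * (c0 * d1)\<close>; expanding \<open>(p - u) * (p - v)\<close>, which is nonnegative,
  then yields u + v \<le> p + c0 * d1.\<close>

lemma four_functions_two_points:
  fixes a0 a1 b0 b1 c0 c1 d0 d1 :: real
  assumes "0 < a0" "0 < a1" "0 < b0" "0 < b1" "0 < c0" "0 < c1" "0 < d0" "0 < d1"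
    and "a1 * b1 \<le> c1 * d1" "a0 * b0 \<le> c0 * d0" "a1 * b0 \<le> c1 * d0" "a0 * b1 \<le> c1 * d0"
  shows "(a1 + a0) * (b1 + b0) \<le> (c1 + c0) * (d1 + d0)"
proof -
  define p u v where "p = c1 * d0" and "u = a1 * b0" and "v = a0 * b1"
  have p: "0 < p" using assms by (simp add: p_def)
  have "u * v \<le> p * (c0 * d1)"
    using mult_mono[OF assms(9,10)] assms by (simp add: p_def u_def v_def ac_simps)
  moreover have "0 \<le> (p - u) * (p - v)"
    using assms by (simp add: p_def u_def v_def)
  ultimately have "p * (u + v) \<le> p * (p + c0 * d1)"
    by (simp add: algebra_simps)
  then have "u + v \<le> p + c0 * d1"
    using p by simp
  then show ?thesis
    using assms(9,10) by (simp add: p_def u_def v_def algebra_simps)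
qed

lemma log_supermodular_mult:
  assumes "log_supermodular f" "log_supermodular g"
  shows "log_supermodular (\<lambda>x. f x * g x)"
  unfolding log_supermodular_def
proof (intro conjI allI)
  fix x y
  have "(f x * f y) * (g x * g y) \<le> (f (sup x y) * f (inf x y)) * (g (sup x y) * g (inf x y))"
    using assms by (intro mult_mono[of "f x * f y"])
      (auto simp: log_supermodular_def less_imp_le intro!: mult_nonneg_nonneg)
  then show "f x * g x * (f y * g y) \<le> f (sup x y) * g (sup x y) * (f (inf x y) * g (inf x y))"
    by (simp add: ac_simps)
  show "0 < f x * g x"
    using assms by (simp add: log_supermodular_def)
qed

text \<open>The operator sums the log-supermodular weight \<open>F\<close> over its first spin. The
  four functions inequality is applied to \<open>F\<close> over \<open>x\<close>, \<open>y\<close>,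
  \<open>sup x y\<close> and \<open>inf x y\<close>, indexed by that spin.\<close>

lemma log_supermodular_ruelle:
  assumes "log_supermodular (\<lambda>x. exp (A x))" "log_supermodular g"
  shows "log_supermodular (ruelle A g)"
proof -
  define F where "F x = exp (A x) * g x" for x
  have F: "log_supermodular F"
    unfolding F_def using assms by (rule log_supermodular_mult)
  then have pos: "0 < F x" and sm: "F x * F y \<le> F (sup x y) * F (inf x y)" for x y
    by (auto simp: log_supermodular_def)
  have eq: "ruelle A g x = F (case_nat (Spin 1) x) + F (case_nat (Spin (-1)) x)" for x
    by (simp add: ruelle_eq F_def)
  have "ruelle A g x * ruelle A g y \<le> ruelle A g (sup x y) * ruelle A g (inf x y)" for x y
    unfolding eq
    using sm[of "case_nat (Spin 1) x" "case_nat (Spin 1) y"]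
      sm[of "case_nat (Spin (-1)) x" "case_nat (Spin (-1)) y"]
      sm[of "case_nat (Spin 1) x" "case_nat (Spin (-1)) y"]
      sm[of "case_nat (Spin (-1)) x" "case_nat (Spin 1) y"]
    by (intro four_functions_two_points)
      (simp_all add: pos sup_case_nat inf_case_nat sup_absorb1 sup_absorb2 inf_absorb1 inf_absorb2)
  then show ?thesis
    by (simp add: log_supermodular_def eq pos add_pos_pos)
qed

lemma log_supermodular_ruelle_pow:
  assumes "log_supermodular (\<lambda>x. exp (A x))"
  shows "log_supermodular ((ruelle A ^^ n) (\<lambda>_. 1))"
  by (induction n) (simp_all add: assms log_supermodular_ruelle, simp add: log_supermodular_def)

text \<open>
  One step of the recursion averages over the first spin, whose probability \<open>p x\<close> of being \<open>1\<close> is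
  increasing in \<open>x\<close> by log-supermodularity at \<open>(1, x)\<close> and \<open>(-1, y)\<close>.
\<close>
lemma finite_gibbs_mono:
  assumes A: "log_supermodular (\<lambda>x. exp (A x))" and f: "mono f"
  shows "mono (finite_gibbs A n f)"
proof (induction n)
  case 0
  then show ?case using f by (simp add: finite_gibbs_def)
next
  case (Suc n)
  define F where "F x = exp (A x) * (ruelle A ^^ n) (\<lambda>_. 1) x" for x
  define r where "r = finite_gibbs A n f"
  define p where
    "p x = F (case_nat (Spin 1) x) / (F (case_nat (Spin 1) x) + F (case_nat (Spin (-1)) x))" for x
  have "log_supermodular F"
    unfolding F_def by (intro log_supermodular_mult A log_supermodular_ruelle_pow)
  then have pos: "0 < F x" and sm: "F x * F y \<le> F (sup x y) * F (inf x y)" for x y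
    by (auto simp: log_supermodular_def)
  have rec: "finite_gibbs A (Suc n) f x =
      p x * r (case_nat (Spin 1) x) + (1 - p x) * r (case_nat (Spin (-1)) x)" for x
  proof -
    have *: "exp (A y) * (ruelle A ^^ n) f y = F y * r y" for y
      using ruelle_pow_one_pos[of n A y] by (simp add: F_def r_def finite_gibbs_def)
    define u v where "u = F (case_nat (Spin 1) x)" and "v = F (case_nat (Spin (-1)) x)"
    have uv: "0 < u" "0 < v" by (simp_all add: u_def v_def pos)
    then have "1 - u / (u + v) = v / (u + v)" by (simp add: field_simps)
    moreover have "finite_gibbs A (Suc n) f x =
        (u * r (case_nat (Spin 1) x) + v * r (case_nat (Spin (-1)) x)) / (u + v)"
      by (simp add: finite_gibbs_def[of A "Suc n"] ruelle_eq * u_def v_def) (simp add: F_def)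
    ultimately show ?thesis
      by (simp add: p_def u_def[symmetric] v_def[symmetric] add_divide_distrib)
  qed
  show ?case
  proof (rule monoI)
    fix x y :: config
    assume xy: "x \<le> y"
    have r: "r u \<le> r v" if "u \<le> v" for u v
      using Suc that by (simp add: r_def monoD)
    have "F (case_nat (Spin 1) x) * F (case_nat (Spin (-1)) y)
        \<le> F (case_nat (Spin 1) y) * F (case_nat (Spin (-1)) x)"
      using sm[of "case_nat (Spin 1) x" "case_nat (Spin (-1)) y"] xy
      by (simp add: sup_case_nat inf_case_nat sup_absorb1 sup_absorb2 inf_absorb1 inf_absorb2)
    then have pxy: "p x \<le> p y"
      by (simp add: p_def divide_le_eq pos add_pos_pos mult.commute pos_le_divide_eq
          pos_divide_le_eq frac_le_eq algebra_simps)
    have p: "0 \<le> p z" "p z \<le> 1" for z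
      using pos[of "case_nat (Spin 1) z"] pos[of "case_nat (Spin (-1)) z"] by (simp_all add: p_def)
    \<comment> \<open>The two monotone dependences are used one after the other: first
      \<open>r\<close> is raised from \<open>x\<close> to \<open>y\<close> with the weight
      \<open>p x\<close> kept, then \<open>p x\<close> is raised to \<open>p y\<close>, whose
      coefficient is nonnegative because \<open>r\<close> is increasing.\<close>
    have "finite_gibbs A (Suc n) f x
        \<le> p x * r (case_nat (Spin 1) y) + (1 - p x) * r (case_nat (Spin (-1)) y)"
      unfolding rec using p[of x] xy by (intro add_mono mult_left_mono r case_nat_mono) auto
    also have "\<dots> = r (case_nat (Spin (-1)) y) + p x * (r (case_nat (Spin 1) y) - r (case_nat (Spin (-1)) y))"
      by (simp add: algebra_simps)
    also have "\<dots> \<le> r (case_nat (Spin (-1)) y) + p y * (r (case_nat (Spin 1) y) - r (case_nat (Spin (-1)) y))"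
      using pxy r[OF case_nat_mono[of "Spin (-1)" "Spin 1" y y]] by (simp add: mult_right_mono)
    also have "\<dots> = finite_gibbs A (Suc n) f y"
      unfolding rec by (simp add: algebra_simps)
    finally show "finite_gibbs A (Suc n) f x \<le> finite_gibbs A (Suc n) f y" .
  qed
qed


section \<open>Uniform convergence of the ratios\<close>

lemma uniform_limit_phi:
  assumes A: "log_supermodular (\<lambda>x. exp (A x))"
    and plus: "boundary_limit A all_plus \<mu>" and minus: "boundary_limit A all_minus \<mu>"
    and B: "finite B"
  shows "uniform_limit UNIV (\<lambda>n. finite_gibbs A n (phi B)) (\<lambda>_. \<integral>x. phi B x \<partial>\<mu>) sequentially"
proof (rule uniform_limitI)
  fix e :: real
  assume "0 < e"
  let ?m = "\<integral>x. phi B x \<partial>\<mu>"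
  have "\<forall>\<^sub>F n in sequentially. dist (finite_gibbs A n (phi B) y) ?m < e"
    if "boundary_limit A y \<mu>" for y
    using that phi_in_phi_algebra[OF B] \<open>0 < e\<close>
    by (intro tendstoD) (auto simp: boundary_limit_def finite_gibbs_def)
  from this[OF plus] this[OF minus]
  show "\<forall>\<^sub>F n in sequentially. \<forall>x\<in>UNIV. dist (finite_gibbs A n (phi B) x) ?m < e"
  proof eventually_elim
    case (elim n)
    have m: "mono (finite_gibbs A n (phi B))"
      by (rule finite_gibbs_mono[OF A phi_mono[OF B]])
    \<comment> \<open>Monotonicity places the ratio at \<open>x\<close> between its values at
      \<open>all_minus\<close> and \<open>all_plus\<close>, both within \<open>e\<close> of
      \<open>?m\<close>; the choice of \<open>n\<close> does not depend on \<open>x\<close>.\<close>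
    have "dist (finite_gibbs A n (phi B) x) ?m < e" for x
      using monoD[OF m all_minus_le[of x]] monoD[OF m le_all_plus[of x]] elim
      unfolding dist_real_def by linarith
    then show ?case by simp
  qed
qed

lemma uniform_limit_phi_span:
  assumes A: "log_supermodular (\<lambda>x. exp (A x))"
    and plus: "boundary_limit A all_plus \<mu>" and minus: "boundary_limit A all_minus \<mu>"
    and f: "phi_span f"
  shows "uniform_limit UNIV (\<lambda>n. finite_gibbs A n f) (\<lambda>_. \<integral>x. f x \<partial>\<mu>) sequentially"
  using f
proof (induction rule: phi_span.induct)
  case (base B c)
  have "bounded_linear ((*) c)"
    by (rule bounded_linear_mult_right)
  from bounded_linear.uniform_limit[OF this uniform_limit_phi[OF A plus minus base]]
  show ?case by (simp add: finite_gibbs_cmult[abs_def])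
next
  case (add f g)
  have "(\<integral>x. f x + g x \<partial>\<mu>) = (\<integral>x. f x \<partial>\<mu>) + (\<integral>x. g x \<partial>\<mu>)"
    using plus add
    by (intro Bochner_Integration.integral_add integrable_continuous continuous_phi_span)
      (auto simp: boundary_limit_def)
  with uniform_limit_add[OF add.IH] show ?case
    by (simp add: finite_gibbs_add[abs_def])
qed

lemma uniform_limit_continuous:
  assumes A: "log_supermodular (\<lambda>x. exp (A x))"
    and plus: "boundary_limit A all_plus \<mu>" and minus: "boundary_limit A all_minus \<mu>"
    and f: "continuous_on UNIV f"
  shows "uniform_limit UNIV (\<lambda>n. finite_gibbs A n f) (\<lambda>_. \<integral>x. f x \<partial>\<mu>) sequentially"
proof (rule uniform_limitI)
  fix e :: real
  assume "0 < e"
  have \<mu>: "borel_probability \<mu>" using plus by (simp add: boundary_limit_def)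
  interpret prob_space \<mu> using \<mu> by (simp add: borel_probability_def)
  obtain g where g: "phi_span g" and fg: "\<And>x. \<bar>f x - g x\<bar> < e / 3"
    using phi_span_dense[OF f, of "e / 3"] \<open>0 < e\<close> by auto
  have int: "integrable \<mu> f" "integrable \<mu> g"
    using integrable_continuous[OF \<mu>] f continuous_phi_span[OF g] by auto
  have "\<bar>\<integral>x. f x - g x \<partial>\<mu>\<bar> \<le> (\<integral>x. \<bar>f x - g x\<bar> \<partial>\<mu>)"
    by (rule integral_abs_bound)
  also have "\<dots> \<le> e / 3"
    using int fg by (intro integral_le_const) (auto simp: less_imp_le)
  finally have lim: "\<bar>(\<integral>x. f x \<partial>\<mu>) - (\<integral>x. g x \<partial>\<mu>)\<bar> \<le> e / 3"
    using int by simp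
  have "\<forall>\<^sub>F n in sequentially. \<forall>x\<in>UNIV. dist (finite_gibbs A n g x) (\<integral>x. g x \<partial>\<mu>) < e / 3"
    using uniform_limitD[OF uniform_limit_phi_span[OF A plus minus g], of "e / 3"] \<open>0 < e\<close> by simp
  then show "\<forall>\<^sub>F n in sequentially. \<forall>x\<in>UNIV. dist (finite_gibbs A n f x) (\<integral>x. f x \<partial>\<mu>) < e"
  proof eventually_elim
    case (elim n)
    \<comment> \<open>An expectation does not increase the supremum norm, so the approximation error
      is at most e / 3 for all \<open>n\<close> and \<open>x\<close> at once.\<close>
    have fg': "\<bar>finite_gibbs A n f x - finite_gibbs A n g x\<bar> \<le> e / 3" for x
      unfolding finite_gibbs_diff[symmetric]
      by (rule abs_finite_gibbs_le) (use fg less_imp_le in blast)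
    have "dist (finite_gibbs A n f x) (\<integral>x. f x \<partial>\<mu>) < e" for x
      using fg'[of x] elim[rule_format, OF UNIV_I, of x] lim unfolding dist_real_def by linarith
    then show ?case by simp
  qed
qed


section \<open>The eigenvalue and the spectral radius\<close>

lemma norm_le_sup_norm:
  assumes "f \<in> cont_complex"
  shows "norm (f x) \<le> sup_norm f"
proof -
  obtain K where "\<And>x. norm (f x) \<le> K"
    using continuous_bounded[of f] assms by (auto simp: cont_complex_def)
  then show ?thesis
    unfolding sup_norm_def by (intro cSUP_upper) (auto simp: bdd_above_def)
qed

lemma sup_norm_le: "(\<And>x. norm (f x) \<le> c) \<Longrightarrow> sup_norm f \<le> c"
  unfolding sup_norm_def by (rule cSUP_least) auto

text \<open>Isolates what ferromagnetism has provided; the spectral part then rests on uniform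
  convergence to a constant alone.\<close>

locale uniform_gibbs =
  fixes A :: "config \<Rightarrow> real" and \<mu> :: "config measure"
  assumes continuous_potential: "continuous_on UNIV A"
    and borel_probability: "borel_probability \<mu>"
    and uniform_limit: "continuous_on UNIV f \<Longrightarrow>
      uniform_limit UNIV (\<lambda>n. finite_gibbs A n f) (\<lambda>_. \<integral>x. f x \<partial>\<mu>) sequentially"
begin

sublocale prob_space \<mu>
  using borel_probability by (simp add: borel_probability_def)

text \<open>If \<mu> is an eigenmeasure, testing with the constant 1 forces this eigenvalue.\<close>

definition eigenvalue :: real
  where "eigenvalue = (\<integral>x. ruelle A (\<lambda>_. 1) x \<partial>\<mu>)"

text \<open>Multiply and divide by the value of the (n+1)-st iterate on 1.\<close>

lemma finite_gibbs_ruelle: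
  "finite_gibbs A n (ruelle A f) y =
    finite_gibbs A (Suc n) f y * finite_gibbs A n (ruelle A (\<lambda>_. 1)) y"
proof -
  have "(ruelle A ^^ n) (ruelle A g) = (ruelle A ^^ Suc n) g" for g :: "config \<Rightarrow> real"
    by (simp only: funpow_Suc_right comp_def)
  then show ?thesis
    using ruelle_pow_one_pos[of "Suc n" A y] by (simp add: finite_gibbs_def del: funpow.simps)
qed

text \<open>Both sides of \<open>finite_gibbs_ruelle\<close> converge at \<open>all_plus\<close>,
  and the limits are compared.\<close>

lemma integral_ruelle:
  assumes f: "continuous_on UNIV f"
  shows "(\<integral>x. ruelle A f x \<partial>\<mu>) = eigenvalue * (\<integral>x. f x \<partial>\<mu>)"
proof -
  have lim: "(\<lambda>n. finite_gibbs A n g all_plus) \<longlonglongrightarrow> (\<integral>x. g x \<partial>\<mu>)" if "continuous_on UNIV g" for g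
    using tendsto_uniform_limitI[OF uniform_limit[OF that], of all_plus] by simp
  note c = continuous_ruelle[OF continuous_potential]
  have "(\<lambda>n. finite_gibbs A (Suc n) f all_plus * finite_gibbs A n (ruelle A (\<lambda>_. 1)) all_plus)
      \<longlonglongrightarrow> (\<integral>x. f x \<partial>\<mu>) * eigenvalue"
    unfolding eigenvalue_def
    by (intro tendsto_mult LIMSEQ_Suc[OF lim[OF f]] lim c continuous_on_const)
  then show ?thesis
    using LIMSEQ_unique[OF lim[OF c[OF f], unfolded finite_gibbs_ruelle[of _ f]]] by (subst mult.commute)
qed

lemma eigenvalue_pos: "0 < eigenvalue"
proof -
  obtain K where K: "\<And>x. norm (A x) \<le> K"
    using continuous_bounded[OF continuous_potential] by blast
  have "- K \<le> A x" for x
    using K[of x] by simp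
  then have "exp (- K) \<le> ruelle A (\<lambda>_. 1) x" for x
    by (simp add: ruelle_eq add_increasing2)
  then have "exp (- K) \<le> eigenvalue"
    unfolding eigenvalue_def
    by (intro integral_ge_const integrable_continuous[OF borel_probability]
        continuous_ruelle continuous_potential) auto
  then show ?thesis
    using exp_gt_zero by (rule less_le_trans[rotated])
qed

text \<open>The quotient of consecutive iterates on 1 is
  \<open>finite_gibbs A n (ruelle A (\<lambda>_. 1))\<close>, which tends uniformly to
  \<open>eigenvalue\<close>. From some \<open>N\<close> on, each step therefore costs a factor at
  most \<open>r\<close>; the earlier steps are absorbed into the constant.\<close>

lemma ruelle_pow_one_growth:
  assumes r: "eigenvalue < r"
  obtains C where "0 < C" "\<And>n x. (ruelle A ^^ n) (\<lambda>_. 1 :: real) x \<le> C * r ^ n"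
proof -
  let ?L = "\<lambda>n x. (ruelle A ^^ n) (\<lambda>_. 1 :: real) x"
  have c: "continuous_on UNIV (ruelle A (\<lambda>_. 1 :: real))"
    by (intro continuous_ruelle continuous_potential continuous_on_const)
  have r0: "0 < r" using r eigenvalue_pos by simp
  have Suc_eq: "?L (Suc n) x = (ruelle A ^^ n) (ruelle A (\<lambda>_. 1)) x" for n x
    by (simp only: funpow_Suc_right comp_def)
  obtain N where N: "dist (finite_gibbs A n (ruelle A (\<lambda>_. 1)) x) eigenvalue < r - eigenvalue"
    if "N \<le> n" for n x
    using uniform_limitD[OF uniform_limit[OF c], of "r - eigenvalue"] r
    by (auto simp: eventually_sequentially eigenvalue_def)
  have late: "?L (Suc n) x \<le> r * ?L n x" if "N \<le> n" for n x
  proof -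
    have "finite_gibbs A n (ruelle A (\<lambda>_. 1)) x < r"
      using N[OF that, of x] by (simp add: dist_real_def)
    then show ?thesis
      using ruelle_pow_one_pos[of n A x] unfolding Suc_eq finite_gibbs_def
      by (simp add: pos_divide_less_eq)
  qed
  obtain b where b: "\<And>x. norm (ruelle A (\<lambda>_. 1 :: real) x) \<le> b"
    using continuous_bounded[OF c] by blast
  \<comment> \<open>\<open>d\<close> bounds the cost of any step. Taking it at least
    \<open>r\<close> makes (d / r) ^ n increasing in \<open>n\<close>, so (d / r) ^ N serves as the
    constant for n \<le> N too.\<close>
  define d where "d = max b r"
  have d: "r \<le> d" "0 < d" "1 \<le> d / r" using r0 by (auto simp: d_def)
  have early: "?L n x \<le> d ^ n" for n x
  proof (induction n)
    case (Suc n)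
    have "?L (Suc n) x \<le> d * ?L n x"
      using norm_ruelle_pow_le[of "ruelle A (\<lambda>_. 1 :: real)" d n A x] b
      unfolding Suc_eq by (force simp: d_def intro: max.coboundedI1)
    also have "\<dots> \<le> d * d ^ n"
      using Suc d by (intro mult_left_mono) auto
    finally show ?case by simp
  qed simp
  have "?L n x \<le> (d / r) ^ N * r ^ n" for n x
  proof (cases "n \<le> N")
    case True
    have "d ^ n = (d / r) ^ n * r ^ n"
      using r0 by (simp add: power_divide)
    also have "\<dots> \<le> (d / r) ^ N * r ^ n"
      using r0 d True by (intro mult_right_mono power_increasing) auto
    finally show ?thesis using early order_trans by blast
  next
    case False
    then have "N \<le> n" by simp
    then show ?thesis
    proof (induction n rule: dec_induct)
      case base
      then show ?case using early[of N x] r0 by (simp add: power_divide)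
    next
      case (step n)
      have "?L (Suc n) x \<le> r * ?L n x" using late step by simp
      also have "\<dots> \<le> r * ((d / r) ^ N * r ^ n)"
        using step r0 by (intro mult_left_mono) auto
      finally show ?case by (simp add: ac_simps)
    qed
  qed
  moreover have "0 < (d / r) ^ N" using d r0 by simp
  ultimately show thesis using that by blast
qed

text \<open>The Neumann series, the sum of the n-th iterate of \<open>f\<close> divided by
  \<open>z ^ Suc n\<close>, inverts z - L. It converges uniformly because the iterates grow at most
  like \<open>r ^ n\<close> with \<open>r < norm z\<close>.\<close>

lemma not_in_spectrum:
  assumes z: "eigenvalue < norm z"
  shows "z \<notin> op_spectrum (ruelle A)"
proof -
  obtain r where r: "eigenvalue < r" "r < norm z" using dense[OF z] by blast
  have r0: "0 < r" and z0: "z \<noteq> 0" using r eigenvalue_pos by auto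
  have q: "norm (r / norm z) < 1" using r r0 z0 by (simp add: abs_divide)
  obtain C where C: "0 < C" "\<And>n x. (ruelle A ^^ n) (\<lambda>_. 1 :: real) x \<le> C * r ^ n"
    using ruelle_pow_one_growth[OF r(1)] by blast
  define res where "res f x n = (ruelle A ^^ n) f x / z ^ Suc n" for f :: "config \<Rightarrow> complex" and x n
  \<comment> \<open>\<open>M s\<close> is the geometric majorant of the series for a function of
    norm \<open>s\<close>, and \<open>K * s\<close> is its sum, so \<open>K\<close> bounds the
    inverse.\<close>
  define K where "K = C / (norm z - r)"
  define M where "M s n = s * C / norm z * (r / norm z) ^ n" for s n
  have M: "M s sums (K * s)" for s
  proof -
    have "(\<lambda>n. (r / norm z) ^ n) sums (1 / (1 - r / norm z))"
      using q by (rule geometric_sums)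
    from sums_mult[OF this, of "s * C / norm z"]
    have "M s sums (s * C / norm z * (1 / (1 - r / norm z)))"
      by (simp add: M_def[abs_def])
    moreover have "s * C / norm z * (1 / (1 - r / norm z)) = K * s"
      using r z0 by (simp add: K_def field_simps)
    ultimately show ?thesis by simp
  qed
  have pow: "norm ((ruelle A ^^ n) f x) \<le> sup_norm f * C * r ^ n" if "f \<in> cont_complex" for f x n
  proof -
    have "0 \<le> sup_norm f"
      using norm_le_sup_norm[OF that, of all_plus] norm_ge_zero by (rule order_trans[rotated])
    then show ?thesis
      using norm_ruelle_pow_le[of f "sup_norm f" n A x] norm_le_sup_norm[OF that]
        mult_left_mono[OF C(2)[of n x], of "sup_norm f"] by (simp add: ac_simps)
  qed
  have res_le: "norm (res f x n) \<le> M (sup_norm f) n" if "f \<in> cont_complex" for f x n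
    using divide_right_mono[OF pow[OF that, of n x], of "norm z ^ Suc n"]
    by (simp add: res_def M_def norm_divide norm_mult norm_power power_divide)
  \<comment> \<open>The series is a left inverse: its terms telescope and the remainder tends to 0.
    Injectivity and the bound on the inverse both follow from this.\<close>
  have res_sums: "res (\<lambda>x. z * g x - ruelle A g x) x sums g x" if g: "g \<in> cont_complex" for g x
  proof -
    let ?t = "\<lambda>n. (ruelle A ^^ n) g x / z ^ n"
    have "(ruelle A ^^ n) (\<lambda>x. z * g x - ruelle A g x) x =
        z * (ruelle A ^^ n) g x - (ruelle A ^^ Suc n) g x" for n
    proof -
      have "(\<lambda>x. z * g x - ruelle A g x) = (\<lambda>x. z * g x + (- 1) * ruelle A g x)" by simp
      then show ?thesis
        by (simp only: ruelle_pow_add ruelle_pow_cmult funpow_Suc_right comp_def) simp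
    qed
    then have tele: "res (\<lambda>x. z * g x - ruelle A g x) x n = ?t n - ?t (Suc n)" for n
      using z0 by (simp add: res_def diff_divide_distrib del: funpow.simps)
    have "?t \<longlonglongrightarrow> 0"
    proof (rule Lim_null_comparison)
      show "\<forall>\<^sub>F n in sequentially. norm (?t n) \<le> sup_norm g * C * (r / norm z) ^ n"
        using pow[OF g] z0
        by (intro always_eventually allI)
          (simp add: norm_divide norm_power power_divide divide_right_mono)
      have "(\<lambda>n. (r / norm z) ^ n) \<longlonglongrightarrow> 0"
        using q by (rule LIMSEQ_power_zero)
      from tendsto_mult_left[OF this, of "sup_norm g * C"]
      show "(\<lambda>n. sup_norm g * C * (r / norm z) ^ n) \<longlonglongrightarrow> 0" by simp
    qed
    from telescope_sums'[OF this] show ?thesis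
      by (simp add: tele[abs_def])
  qed
  have cont: "(\<lambda>x. z * g x - ruelle A g x) \<in> cont_complex" if "g \<in> cont_complex" for g
    using that continuous_ruelle[OF continuous_potential]
    by (auto simp: cont_complex_def intro!: continuous_intros)
  have "inj_on (\<lambda>g x. z * g x - ruelle A g x) cont_complex"
  proof (rule inj_onI)
    fix f g
    assume fg: "f \<in> cont_complex" "g \<in> cont_complex"
      and eq: "(\<lambda>x. z * f x - ruelle A f x) = (\<lambda>x. z * g x - ruelle A g x)"
    show "f = g"
      using res_sums[OF fg(1)] res_sums[OF fg(2)] sums_unique2 unfolding eq by blast
  qed
  moreover have "f \<in> (\<lambda>g x. z * g x - ruelle A g x) ` cont_complex" if f: "f \<in> cont_complex" for f
  proof
    define g where "g x = (\<Sum>n. res f x n)" for x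
    have summable: "summable (res f x)" for x
      using summable_comparison_test'[OF sums_summable[OF M[of "sup_norm f"]]] res_le[OF f] by blast
    have "uniform_limit UNIV (\<lambda>n x. \<Sum>i<n. res f x i) g sequentially"
      unfolding g_def using res_le[OF f] sums_summable[OF M] by (intro Weierstrass_m_test) auto
    moreover have "continuous_on UNIV (\<lambda>x. \<Sum>i<n. res f x i)" for n
      unfolding res_def using f z0
      by (intro continuous_intros continuous_ruelle_pow continuous_potential) (auto simp: cont_complex_def)
    ultimately show "g \<in> cont_complex"
      unfolding cont_complex_def using uniform_limit_theorem[OF always_eventually]
      by (metis mem_Collect_eq trivial_limit_sequentially)
    have "z * g x - ruelle A g x = f x" for x
    proof -
      have "(\<lambda>n. ruelle A (\<lambda>y. res f y n) x) sums ruelle A g x"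
        unfolding ruelle_eq g_def
        by (intro sums_add bounded_linear.sums[OF bounded_linear_scaleR_right] summable_sums summable)
      \<comment> \<open>Applying the operator shifts the series by one index, so z - L leaves only
        the term of index 0, which is \<open>f x / z\<close> before multiplication by
        \<open>z\<close>.\<close>
      moreover have "ruelle A (\<lambda>y. res f y n) x = z * res f x (Suc n)" for n
        using z0 by (simp add: ruelle_eq res_def scaleR_conv_of_real field_simps)
      ultimately have "(\<lambda>n. z * res f x (Suc n)) sums ruelle A g x" by simp
      then have "(\<lambda>n. z * res f x n) sums (ruelle A g x + z * res f x 0)"
        by (rule sums_Suc)
      moreover have "(\<lambda>n. z * res f x n) sums (z * g x)"
        unfolding g_def by (intro sums_mult summable_sums summable)
      ultimately have "z * g x = ruelle A g x + z * res f x 0"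
        using sums_unique2 by blast
      then show ?thesis using z0 by (simp add: res_def)
    qed
    then show "f = (\<lambda>x. z * g x - ruelle A g x)" by auto
  qed
  moreover have "sup_norm g \<le> K * sup_norm (\<lambda>x. z * g x - ruelle A g x)" if g: "g \<in> cont_complex" for g
  proof (rule sup_norm_le)
    fix x
    let ?f = "\<lambda>x. z * g x - ruelle A g x"
    have "norm (suminf (res ?f x)) \<le> suminf (M (sup_norm ?f))"
      using res_le[OF cont[OF g]] sums_summable[OF M] by (intro norm_suminf_le) auto
    then show "norm (g x) \<le> K * sup_norm ?f"
      using sums_unique[OF res_sums[OF g, of x]] sums_unique[OF M[of "sup_norm ?f"]] by simp
  qed
  ultimately show ?thesis
    using cont by (auto simp: op_spectrum_def bij_betw_def image_subset_iff)
qed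

text \<open>
  \<open>\<lambda> - L\<close> is not onto, since \<open>\<mu>\<close> annihilates its range.
\<close>
lemma eigenvalue_in_spectrum: "complex_of_real eigenvalue \<in> op_spectrum (ruelle A)"
proof (rule ccontr)
  let ?T = "\<lambda>g x. complex_of_real eigenvalue * g x - ruelle A g x"
  assume "complex_of_real eigenvalue \<notin> op_spectrum (ruelle A)"
  then have "?T ` cont_complex = cont_complex"
    by (simp add: op_spectrum_def bij_betw_def)
  moreover have "(\<lambda>_. 1) \<in> cont_complex" by (simp add: cont_complex_def)
  ultimately have "(\<lambda>_. 1) \<in> ?T ` cont_complex" by simp
  then obtain g where T: "(\<lambda>_. 1) = ?T g" and g: "g \<in> cont_complex" by (rule imageE)
  \<comment> \<open>The weights and \<open>eigenvalue\<close> are real, so real parts may be taken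
    throughout. This reduces the equation to a real function, to which
    \<open>integral_ruelle\<close> applies; integrating gives 0 = 1.\<close>
  have "Re (?T g x) = 1" for x
    unfolding fun_cong[OF T, of x, symmetric] by simp
  then have eq: "eigenvalue * Re (g x) - ruelle A (\<lambda>x. Re (g x)) x = 1" for x
    by (simp add: ruelle_eq)
  have c: "continuous_on UNIV (\<lambda>x. Re (g x))"
    using g by (auto simp: cont_complex_def intro!: continuous_intros)
  have "(\<integral>x. eigenvalue * Re (g x) - ruelle A (\<lambda>x. Re (g x)) x \<partial>\<mu>) = 0"
    using integral_ruelle[OF c] integrable_continuous[OF borel_probability c]
      integrable_continuous[OF borel_probability continuous_ruelle[OF continuous_potential c]]
    by simp
  then show False
    unfolding eq by (simp add: prob_space)
qed

lemma ruelle_radius_eq: "ruelle_radius A = eigenvalue"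
  unfolding ruelle_radius_def op_spectral_radius_def
proof (rule cSup_eq_maximum)
  show "eigenvalue \<in> norm ` op_spectrum (ruelle A)"
    using eigenvalue_in_spectrum eigenvalue_pos by (intro image_eqI) auto
  show "s \<le> eigenvalue" if "s \<in> norm ` op_spectrum (ruelle A)" for s
    using that not_in_spectrum by (auto simp: not_less[symmetric])
qed

text \<open>Since \<open>ruelle_radius A\<close> is \<open>eigenvalue\<close>, integrating the n-th
  iterate of \<open>f\<close> against \<nu> gives \<open>eigenvalue ^ n\<close> times the integral
  of \<open>f\<close>. The uniform estimate, integrated and divided by this positive power, bounds
  the difference of the integrals of \<open>phi B\<close> by any \<open>e\<close>.\<close>

lemma eigenprobability_unique:
  assumes "\<nu> \<in> eigenprobabilities A"
  shows "\<nu> = \<mu>"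
proof (rule borel_probability_eqI[OF _ borel_probability])
  show \<nu>: "borel_probability \<nu>" using assms by (simp add: eigenprobabilities_def)
  interpret \<nu>: prob_space \<nu> using \<nu> by (simp add: borel_probability_def)
  have pow: "(\<integral>x. (ruelle A ^^ n) f x \<partial>\<nu>) = eigenvalue ^ n * (\<integral>x. f x \<partial>\<nu>)"
    if "continuous_on UNIV f" for f n
  proof (induction n)
    case (Suc n)
    then show ?case
      using assms continuous_ruelle_pow[OF continuous_potential that, of n]
      by (simp add: eigenprobabilities_def ruelle_radius_eq)
  qed simp
  fix B :: "nat set"
  let ?m = "\<integral>x. phi B x \<partial>\<mu>" and ?k = "\<integral>x. phi B x \<partial>\<nu>"
  have "\<bar>?k - ?m\<bar> \<le> e" if e: "0 < e" for e
  proof -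
    obtain n where n: "\<And>x. dist (finite_gibbs A n (phi B) x) ?m < e"
      using uniform_limitD[OF uniform_limit[OF continuous_phi[of B]] e]
      by (auto simp: eventually_sequentially)
    let ?L = "\<lambda>f x. (ruelle A ^^ n) f x :: real"
    have int: "integrable \<nu> (?L f)" if "continuous_on UNIV f" for f
      by (intro integrable_continuous[OF \<nu>] continuous_ruelle_pow continuous_potential that)
    note i = int[OF continuous_phi, of B] int[OF continuous_on_const, of 1]
    have bound: "\<bar>?L (phi B) x - ?m * ?L (\<lambda>_. 1) x\<bar> \<le> e * ?L (\<lambda>_. 1) x" for x
    proof -
      have pos: "0 < ?L (\<lambda>_. 1) x" by (rule ruelle_pow_one_pos)
      have "?L (phi B) x - ?m * ?L (\<lambda>_. 1) x = (finite_gibbs A n (phi B) x - ?m) * ?L (\<lambda>_. 1) x"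
        using pos by (simp add: finite_gibbs_def left_diff_distrib)
      then show ?thesis
        using n[of x] pos by (simp add: abs_mult dist_real_def)
    qed
    have "\<bar>\<integral>x. ?L (phi B) x - ?m * ?L (\<lambda>_. 1) x \<partial>\<nu>\<bar>
        \<le> (\<integral>x. \<bar>?L (phi B) x - ?m * ?L (\<lambda>_. 1) x\<bar> \<partial>\<nu>)"
      by (rule integral_abs_bound)
    also have "\<dots> \<le> (\<integral>x. e * ?L (\<lambda>_. 1) x \<partial>\<nu>)"
      using i bound by (intro integral_mono) auto
    finally have "\<bar>eigenvalue ^ n * ?k - ?m * eigenvalue ^ n\<bar> \<le> e * eigenvalue ^ n"
      using i pow[OF continuous_phi, of n B] pow[OF continuous_on_const, of n 1]
      by (simp add: \<nu>.prob_space)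
    moreover have "eigenvalue ^ n * ?k - ?m * eigenvalue ^ n = eigenvalue ^ n * (?k - ?m)"
      by (simp add: algebra_simps)
    moreover have "0 < eigenvalue ^ n" using eigenvalue_pos by simp
    ultimately show ?thesis
      by (simp add: abs_mult mult.commute)
  qed
  then have "\<bar>?k - ?m\<bar> \<le> 0"
    by (rule field_le_epsilon) simp
  then show "?k = ?m" by simp
qed

lemma eigenprobabilities_eq: "eigenprobabilities A = {\<mu>}"
proof
  show "eigenprobabilities A \<subseteq> {\<mu>}"
    using eigenprobability_unique by blast
  show "{\<mu>} \<subseteq> eigenprobabilities A"
    by (simp add: eigenprobabilities_def borel_probability integral_ruelle ruelle_radius_eq)
qed

end


section \<open>The Ising potential\<close>

context
  fixes h :: real and a :: "nat \<Rightarrow> real"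
  assumes nonneg: "\<And>k. k \<ge> 1 \<Longrightarrow> a k \<ge> 0"
    and summable_coeffs: "summable (\<lambda>k. a (Suc k))"
begin

lemma norm_interaction_le: "norm (a (Suc k) * val s) \<le> a (Suc k)"
  by (simp add: abs_mult nonneg)

lemma summable_interaction: "summable (\<lambda>k. a (Suc k) * val (x (Suc k)))"
  by (rule summable_comparison_test'[OF summable_coeffs, of 0]) (rule norm_interaction_le)

lemma continuous_ising_potential: "continuous_on UNIV (ising_potential h a)"
proof -
  have "uniform_limit UNIV (\<lambda>n x. \<Sum>k<n. a (Suc k) * val (x (Suc k)))
      (\<lambda>x :: config. \<Sum>k. a (Suc k) * val (x (Suc k))) sequentially"
    by (rule Weierstrass_m_test[OF norm_interaction_le summable_coeffs])
  then have "continuous_on UNIV (\<lambda>x :: config. \<Sum>k. a (Suc k) * val (x (Suc k)))"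
    by (rule uniform_limit_theorem[rotated])
      (auto intro!: always_eventually continuous_intros continuous_val)
  then show ?thesis
    unfolding ising_potential_def[abs_def] by (intro continuous_intros continuous_val)
qed

text \<open>The exponent is supermodular: each pair term is so because its coefficient is
  nonnegative, the field term is modular, and summation preserves the inequality.\<close>

lemma log_supermodular_ising_potential: "log_supermodular (\<lambda>x. exp (ising_potential h a x))"
proof -
  \<comment> \<open>The factor \<open>val (x 0)\<close> is moved into the series so that pairs of
    sites can be compared term by term.\<close>
  have eq: "ising_potential h a x =
      h * val (x 0) + (\<Sum>k. a (Suc k) * (val (x 0) * val (x (Suc k))))" for x :: config
    using suminf_mult[OF summable_interaction, of "val (x 0)" x]
    by (simp add: ising_potential_def ac_simps)
  have sm: "summable (\<lambda>k. a (Suc k) * (val (x 0) * val (x (Suc k))))" for x :: config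
    using summable_mult[OF summable_interaction, of "val (x 0)" x] by (simp add: ac_simps)
  have "ising_potential h a x + ising_potential h a y
      \<le> ising_potential h a (sup x y) + ising_potential h a (inf x y)" for x y
  proof -
    have "(\<Sum>k. a (Suc k) * (val (x 0) * val (x (Suc k))) + a (Suc k) * (val (y 0) * val (y (Suc k))))
      \<le> (\<Sum>k. a (Suc k) * (val (sup x y 0) * val (sup x y (Suc k))) +
          a (Suc k) * (val (inf x y 0) * val (inf x y (Suc k))))"
      using mult_left_mono[OF val_supermodular nonneg]
      by (intro suminf_le summable_add sm) (simp add: distrib_left[symmetric])
    moreover have "h * val (x 0) + h * val (y 0) = h * val (sup x y 0) + h * val (inf x y 0)"
      by (simp add: distrib_left[symmetric] val_modular)
    ultimately show ?thesis
      using suminf_add[OF sm[of x] sm[of y]] suminf_add[OF sm[of "sup x y"] sm[of "inf x y"]]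
      unfolding eq by linarith
  qed
  then show ?thesis
    by (simp add: log_supermodular_def exp_add[symmetric])
qed

end

theorem theorem5:
  fixes h :: real and a :: "nat \<Rightarrow> real" and \<mu>_plus \<mu>_minus :: "config measure"
  assumes "\<And>k. k \<ge> 1 \<Longrightarrow> a k \<ge> 0"
    and "summable (\<lambda>k. a (Suc k))"
    and "boundary_limit (ising_potential h a) all_plus \<mu>_plus"
    and "boundary_limit (ising_potential h a) all_minus \<mu>_minus"
    and "\<mu>_plus = \<mu>_minus"
  shows "is_singleton (eigenprobabilities (ising_potential h a))"
proof -
  \<comment> \<open>Equality of the two boundary limits enters here: it supplies the same limit
    measure at both extremal configurations.\<close>
  have "uniform_gibbs (ising_potential h a) \<mu>_plus"
  proof
    show "continuous_on UNIV (ising_potential h a)"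
      using assms(1,2) by (rule continuous_ising_potential)
    show "borel_probability \<mu>_plus"
      using assms(3) by (simp add: boundary_limit_def)
    show "uniform_limit UNIV (\<lambda>n. finite_gibbs (ising_potential h a) n f)
        (\<lambda>_. \<integral>x. f x \<partial>\<mu>_plus) sequentially" if "continuous_on UNIV f" for f
      using uniform_limit_continuous[OF log_supermodular_ising_potential[OF assms(1,2)] assms(3)]
        assms(4,5) that by blast
  qed
  then show ?thesis
    using uniform_gibbs.eigenprobabilities_eq by (auto simp: is_singleton_def)
qed

end
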